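(* Let $\varphi_1=\tfrac12\varphi$, where $\varphi$ is a Jacob's ladder, and let $\tilde Z^2(t)=\frac{d\varphi_1(t)}{dt}$. There is a constant $T_0=T_0[\varphi_1]$ such that for every $T\ge T_0$, with $\mathring{T}=\varphi_1^{-1}(T)$ and $\mathring{(T+2)}=\varphi_1^{-1}(T+2)$, the functions $P_n(\varphi_1(t)-T-1)$, $t\in[\mathring{T},\mathring{(T+2)}]$, $n=0,1,2,\dots$, where $P_n$ is the $n$-th Legendre polynomial, form an orthogonal system on $[\mathring{T},\mathring{(T+2)}]$ with weight function $\tilde Z^2(t)$; that is, for all $m,n\in\{0,1,2,\dots\}$, $$\int_{\mathring{T}}^{\mathring{(T+2)}}P_m(\varphi_1(t)-T-1)\,P_n(\varphi_1(t)-T-1)\,\tilde Z^2(t)\,dt=0\quad(m\neq n),$$ $$\int_{\mathring{T}}^{\mathring{(T+2)}}\left[P_n(\varphi_1(t)-T-1)\right]^2\tilde Z^2(t)\,dt=\frac{2}{2n+1}.$$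
   Context: Hardy's function: $Z(t)=e^{i\vartheta(t)}\zeta(\tfrac12+it)$ with $\vartheta(t)=-\tfrac t2\ln\pi+\operatorname{Im}\ln\Gamma(\tfrac14+i\tfrac t2)$, where $\zeta$ is the Riemann zeta-function; thus $Z$ is real-valued and $Z^2(t)=|\zeta(\tfrac12+it)|^2$. Jacob's ladder: fix an infinitely differentiable, increasing, unbounded function $\mu:[y_0,\infty)\to\mathbb{R}$ with $\mu(y)\ge 7y\ln y$. The Jacob's ladder $\varphi$ (associated with $\mu$) is the solution $X(T)=\varphi(T)$, defined for all sufficiently large $T$, of the nonlinear integral equation $$\int_0^{\mu[X(T)]}Z^2(t)e^{-\frac{2}{X(T)}t}\,dt=\int_0^T Z^2(t)\,dt .$$ Put $\varphi_1(t)=\tfrac12\varphi(t)$. For large $t$ the function $\varphi_1$ is continuously differentiable, strictly increasing and unbounded, so it has an inverse $\varphi_1^{-1}$ on a half-line; its derivative is denoted $\tilde Z^2(t)=\frac{d\varphi_1(t)}{dt}$. With $\Phi(y)=\int_0^{\mu(y)}Z^2(t)e^{-2t/y}\,dt$ one has $\tilde Z^2(t)=\frac{Z^2(t)}{2\Phi'(\varphi(t))}$. The Legendre polynomials are the Jacobi polynomials with $\alpha=\beta=0$: $P_n(x)=\frac{(-1)^n}{2^nn!}\frac{d^n}{dx^n}\left[(1-x^2)^n\right]$. *)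

theory Defs
  imports "HOL-Complex_Analysis.Complex_Analysis"
begin

text \<open>
  The Riemann zeta-function as the analytic continuation of its Dirichlet series. By the identity
  theorem the continuation is unique on the punctured plane; only the value at the pole
  is left unspecified.
\<close>

definition riemann_zeta :: "complex \<Rightarrow> complex" where
  "riemann_zeta = (SOME f. f holomorphic_on (- {1}) \<and>
     (\<forall>s. Re s > 1 \<longrightarrow> (\<lambda>n. of_nat (Suc n) powr (- s)) sums f s))"

text \<open>
  The library function \<^const>\<open>ln_Gamma\<close> on the complex numbers is the branch that is holomorphic
  off the non-positive real axis and real on the positive one.
\<close>

definition hardy_theta :: "real \<Rightarrow> real" where
  "hardy_theta t = - (t / 2) * ln pi + Im (ln_Gamma (1 / 4 + \<i> * of_real (t / 2)))"

text \<open>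
  By the functional equation the product below is real, so \<^const>\<open>Re\<close> only adjusts the type.
\<close>

definition hardy_Z :: "real \<Rightarrow> real" where
  "hardy_Z t = Re (exp (\<i> * of_real (hardy_theta t)) * riemann_zeta (1 / 2 + \<i> * of_real t))"

text \<open>
  Infinite differentiability on the closed half-line is witnessed by the sequence \<open>D\<close> of successive
  derivatives, one-sided at \<open>y\<^sub>0\<close>. Monotonicity is not required to be strict, which covers both
  readings of ``increasing''. Positivity of \<open>y\<^sub>0\<close> makes \<open>ln y\<close> and \<open>2 / y\<close> meaningful.
\<close>

definition ladder_scale :: "real \<Rightarrow> (real \<Rightarrow> real) \<Rightarrow> bool" where
  "ladder_scale y\<^sub>0 \<mu> \<longleftrightarrow>
     0 < y\<^sub>0 \<and>
     (\<exists>D :: nat \<Rightarrow> real \<Rightarrow> real. D 0 = \<mu> \<and>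
        (\<forall>n. \<forall>y\<ge>y\<^sub>0. (D n has_real_derivative D (Suc n) y) (at y within {y\<^sub>0..}))) \<and>
     mono_on {y\<^sub>0..} \<mu> \<and>
     \<not> bdd_above (\<mu> ` {y\<^sub>0..}) \<and>
     (\<forall>y\<ge>y\<^sub>0. \<mu> y \<ge> 7 * y * ln y)"

text \<open>
  The half-line \<open>[t\<^sub>0, \<infinity>)\<close> is the domain of the ladder; values of \<open>\<phi>\<close> to the left of \<open>t\<^sub>0\<close> are
  irrelevant.
\<close>

definition jacobs_ladder ::
    "real \<Rightarrow> (real \<Rightarrow> real) \<Rightarrow> real \<Rightarrow> (real \<Rightarrow> real) \<Rightarrow> bool" where
  "jacobs_ladder y\<^sub>0 \<mu> t\<^sub>0 \<phi> \<longleftrightarrow>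
     0 < t\<^sub>0 \<and>
     (\<forall>T\<ge>t\<^sub>0. \<phi> T \<ge> y\<^sub>0 \<and>
        integral {0..\<mu> (\<phi> T)} (\<lambda>t. (hardy_Z t)\<^sup>2 * exp (- (2 / \<phi> T) * t)) =
        integral {0..T} (\<lambda>t. (hardy_Z t)\<^sup>2))"

definition legendre_P :: "nat \<Rightarrow> real \<Rightarrow> real" where
  "legendre_P n x = (- 1) ^ n / (2 ^ n * fact n) * (deriv ^^ n) (\<lambda>u. (1 - u\<^sup>2) ^ n) x"

end

theory Submission
  imports Defs
begin

text \<open>
  The integrals reduce to Legendre's orthogonality on \<open>[-1, 1]\<close> by the substitution
  \<open>u = \<phi>\<^sub>1(t) - T - 1\<close>, so what has to be shown is that \<open>\<phi>\<close> is eventually differentiable, strictly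
  increasing and unbounded. Put \<open>\<Phi>(y) = \<integral>\<^sub>0\<^bsup>\<mu>(y)\<^esup> Z\<^sup>2(t) e\<^bsup>-2t/y\<^esup> dt\<close> and \<open>F(T) = \<integral>\<^sub>0\<^bsup>T\<^esup> Z\<^sup>2\<close>. The ladder is
  \<open>\<phi> = \<Phi>\<^bsup>-1\<^esup> \<circ> F\<close>, where \<open>\<Phi>' > 0\<close> and \<open>F\<close> is strictly increasing because \<open>Z\<close> does not vanish on any
  interval, and \<open>\<phi>\<close> is unbounded because \<open>\<Phi>(y) < F(\<mu>(y))\<close>; no mean value theorem for \<open>Z\<close> is needed.

  That \<open>Z\<close> does not vanish on an interval follows from the identity theorem, since \<open>Z\<close> extends
  holomorphically to a strip around the real axis and \<open>Z(0) = \<zeta>(1/2) < 0\<close>. The continuation of \<open>\<zeta>\<close>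
  itself is obtained by Taylor expansion of the summands of \<open>1 = \<Sum>\<^sub>n (n\<^bsup>1-s\<^esup> - (n+1)\<^bsup>1-s\<^esup>)\<close>, which
  expresses \<open>(s-1)\<zeta>(s)\<close> through its values at \<open>s+1, s+2, \<dots>\<close>.
\<close>

section \<open>Orthogonality of the Legendre polynomials\<close>

lemma funpow_deriv_poly:
  fixes p :: "'a::real_normed_field poly"
  shows "(deriv ^^ n) (poly p) = poly ((pderiv ^^ n) p)"
proof (induction n)
  case (Suc n)
  have "deriv (poly q) = poly (pderiv q)" for q :: "'a poly"
    by (rule ext) (rule DERIV_imp_deriv[OF poly_DERIV])
  then show ?case by (simp add: Suc)
qed auto

abbreviation legendre_base :: "nat \<Rightarrow> real poly" where
  "legendre_base n \<equiv> [:1, 0, -1:] ^ n"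

lemma legendre_P_eq_poly:
  "legendre_P n = poly (smult ((- 1) ^ n / (2 ^ n * fact n)) ((pderiv ^^ n) (legendre_base n)))"
proof -
  have "(\<lambda>u. (1 - u\<^sup>2) ^ n) = poly (legendre_base n)"
    by (simp add: fun_eq_iff power2_eq_square)
  then show ?thesis
    by (simp only: legendre_P_def[abs_def] fun_eq_iff funpow_deriv_poly poly_smult simp_thms)
qed

section \<open>Repeated integration by parts against powers of 1 - x^2\<close>

text \<open>By the product rule each differentiation costs at most one factor \<open>q\<close>. With
  \<open>q\<close> = 1 - x^2 this makes the boundary terms at -1 and 1 vanish.\<close>

lemma dvd_higher_pderiv_power:
  fixes q :: "'a::idom poly"
  assumes "k \<le> n"
  shows "q ^ (n - k) dvd (pderiv ^^ k) (q ^ n)"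
  using assms
proof (induction k)
  case (Suc k)
  have *: "n - k = Suc (n - Suc k)" using Suc.prems by simp
  obtain r where r: "(pderiv ^^ k) (q ^ n) = q ^ (n - k) * r"
    using Suc by (auto elim!: dvdE)
  have "(pderiv ^^ Suc k) (q ^ n) = q ^ (n - Suc k) *
      (q * pderiv r + smult (of_nat (n - k)) (pderiv q) * r)"
    unfolding funpow.simps o_def r unfolding * pderiv_mult pderiv_power_Suc
    by (simp add: algebra_simps)
  then show ?case by simp
qed simp

lemma higher_pderiv_legendre_base_endpoint:
  assumes "k < n" "x = 1 \<or> x = -1"
  shows "poly ((pderiv ^^ k) (legendre_base n)) x = 0"
proof -
  have "[:1, 0, -1:] ^ (n - k) dvd (pderiv ^^ k) (legendre_base n)"
    using assms by (intro dvd_higher_pderiv_power) simp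
  then obtain r where "(pderiv ^^ k) (legendre_base n) = [:1, 0, -1:] ^ (n - k) * r"
    by (auto elim!: dvdE)
  then show ?thesis using assms by auto
qed

lemma integral_poly_pderiv:
  fixes p :: "real poly"
  assumes "a \<le> b"
  shows "(poly (pderiv p) has_integral poly p b - poly p a) {a..b}"
  by (rule fundamental_theorem_of_calculus[OF assms],
    unfold has_real_derivative_iff_has_vector_derivative[symmetric])
    (rule has_field_derivative_at_within[OF poly_DERIV])

lemma poly_integrable_on: "poly (p :: real poly) integrable_on {a..b}"
  by (intro integrable_continuous_real continuous_intros)

text \<open>Integration by parts, \<open>k\<close> times. Since \<open>k \<le> n\<close>, every
  boundary term contains a derivative of (1 - x^2)^n of order below \<open>n\<close>, which is zero
  at both endpoints. The induction varies \<open>q\<close> because each step differentiates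
  it.\<close>

lemma integral_mult_higher_pderiv_legendre_base:
  assumes "k \<le> n"
  shows "integral {-1..1} (poly (q * (pderiv ^^ k) (legendre_base n))) =
    (-1) ^ k * integral {-1..1} (poly ((pderiv ^^ k) q * legendre_base n))"
  using assms
proof (induction k arbitrary: q)
  case (Suc k)
  let ?w = "(pderiv ^^ k) (legendre_base n)"
  have "integral {-1..1} (poly (pderiv (q * ?w))) = poly (q * ?w) 1 - poly (q * ?w) (-1)"
    by (intro integral_unique integral_poly_pderiv) simp
  also have "\<dots> = 0"
    using higher_pderiv_legendre_base_endpoint[of k n] Suc.prems by simp
  finally have "integral {-1..1} (\<lambda>x. poly (q * pderiv ?w) x + poly (pderiv q * ?w) x) = 0"
    by (simp add: pderiv_mult algebra_simps fun_eq_iff del: poly_mult flip: poly_add)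
  then have "integral {-1..1} (poly (q * pderiv ?w)) = - integral {-1..1} (poly (pderiv q * ?w))"
    by (subst (asm) integral_add[OF poly_integrable_on poly_integrable_on]) simp
  also have "\<dots> = (-1) ^ Suc k * integral {-1..1} (poly ((pderiv ^^ k) (pderiv q) * legendre_base n))"
    using Suc.IH[of "pderiv q"] Suc.prems by (simp del: poly_mult mult_pCons_right)
  finally show ?case by (simp add: funpow_swap1 del: poly_mult)
qed simp

section \<open>Integral of (1 - x^2)^n, orthogonality and norms\<close>

text \<open>Integrating the derivative of x (1 - x^2)^(n+1), which vanishes at both endpoints, gives
  the recursion I(n+1) = (2n+2)/(2n+3) I(n).\<close>

lemma integral_legendre_base:
  "integral {-1..1} (poly (legendre_base n)) = 2 ^ (2 * n + 1) * (fact n)\<^sup>2 / fact (2 * n + 1)"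
proof (induction n)
  case 0
  have "poly (legendre_base 0) = (\<lambda>x. 1)" by (simp add: fun_eq_iff)
  then show ?case by simp
next
  case (Suc n)
  \<comment> \<open>The product rule produces x^2 (1 - x^2)^n; writing x^2 as 1 - (1 - x^2) leaves
    only powers of 1 - x^2.\<close>
  have eq: "pderiv ([:0, 1:] * legendre_base (Suc n)) =
      smult (2 * real n + 3) (legendre_base (Suc n)) - smult (2 * real n + 2) (legendre_base n)"
  proof (subst poly_eq_poly_eq_iff[symmetric], rule ext)
    fix x
    show "poly (pderiv ([:0, 1:] * legendre_base (Suc n))) x =
        poly (smult (2 * real n + 3) (legendre_base (Suc n)) - smult (2 * real n + 2) (legendre_base n)) x"
      unfolding pderiv_mult pderiv_power_Suc by (simp add: pderiv_pCons algebra_simps)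
  qed
  have "integral {-1..1} (poly (pderiv ([:0, 1:] * legendre_base (Suc n)))) = 0"
    by (subst integral_unique[OF integral_poly_pderiv]) auto
  then have "integral {-1..1} (\<lambda>x. (2 * real n + 3) * poly (legendre_base (Suc n)) x -
      (2 * real n + 2) * poly (legendre_base n) x) = 0"
    unfolding eq poly_diff[abs_def] poly_smult[abs_def] .
  then have "(2 * real n + 3) * integral {-1..1} (poly (legendre_base (Suc n))) =
      (2 * real n + 2) * integral {-1..1} (poly (legendre_base n))"
    by (subst (asm) integral_diff)
      (auto intro!: integrable_continuous_real continuous_intros simp del: poly_power power_Suc)
  moreover have *: "2 * real n + 3 \<noteq> 0" by simp
  ultimately have "integral {-1..1} (poly (legendre_base (Suc n))) = (2 * real n + 2) / (2 * real n + 3) *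
      (2 ^ (2 * n + 1) * (fact n)\<^sup>2 / fact (2 * n + 1))"
    unfolding Suc
    by (simp only: times_divide_eq_left nonzero_eq_divide_eq mult.commute[of _ "2 * real n + 3"] *)
  also have "\<dots> = 2 ^ (2 * Suc n + 1) * (fact (Suc n))\<^sup>2 / fact (2 * Suc n + 1)"
  proof -
    \<comment> \<open>Powers and factorials become opaque variables. The fraction is expanded by 2x
      + 2, using (2x + 2)^2 = 4 (x + 1)^2.\<close>
    have alg: "(2 * x + 2) / (2 * x + 3) * (A * F\<^sup>2 / G) =
        4 * A * ((x + 1) * F)\<^sup>2 / ((2 * x + 3) * (2 * x + 2) * G)"
      if "x \<ge> 0" "G > 0" for x A F G :: real
    proof -
      have "2 * x + 3 \<noteq> 0" "2 * x + 2 \<noteq> 0" "G \<noteq> 0" using that by auto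
      then show ?thesis by (simp add: frac_eq_eq) algebra
    qed
    have "fact (2 * Suc n + 1) = (2 * real n + 3) * (2 * real n + 2) * fact (2 * n + 1)"
      by (simp add: algebra_simps)
    moreover have "fact (Suc n) = (real n + 1) * fact n" by simp
    moreover have "(2::real) ^ (2 * Suc n + 1) = 4 * 2 ^ (2 * n + 1)" by simp
    ultimately show ?thesis
      using alg[of "real n" "fact (2 * n + 1)" "2 ^ (2 * n + 1)" "fact n"] by (simp only: fact_gt_zero of_nat_0_le_iff)
  qed
  finally show ?case .
qed

text \<open>The degree is 2n, so only the leading coefficient survives 2n differentiations.\<close>

lemma higher_pderiv_legendre_base:
  "(pderiv ^^ (2 * n)) (legendre_base n) = [:(-1) ^ n * fact (2 * n):]"
proof (rule poly_eqI)
  fix i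
  have deg: "Polynomial.degree (legendre_base n) = 2 * n"
    by (simp add: degree_power_eq)
  have "lead_coeff (legendre_base n) = (-1) ^ n"
    by (subst lead_coeff_power) simp
  then have lead: "coeff (legendre_base n) (2 * n) = (-1) ^ n"
    by (simp add: deg)
  show "coeff ((pderiv ^^ (2 * n)) (legendre_base n)) i = coeff [:(-1) ^ n * fact (2 * n):] i"
  proof (cases i)
    case 0
    then show ?thesis by (simp add: coeff_higher_pderiv lead pochhammer_fact)
  next
    case (Suc j)
    then show ?thesis using deg by (simp add: coeff_higher_pderiv coeff_eq_0)
  qed
qed

text \<open>All \<open>n\<close> derivatives in Rodrigues' formula are moved onto the other factor,
  whose degree is at most \<open>m < n\<close>.\<close>

lemma legendre_orthogonal_less:
  assumes "m < n"
  shows "integral {-1..1} (\<lambda>x. legendre_P m x * legendre_P n x) = 0"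
proof -
  define q where "q = smult ((- 1) ^ m / (2 ^ m * fact m)) ((pderiv ^^ m) (legendre_base m))"
  define c :: real where "c = (- 1) ^ n / (2 ^ n * fact n)"
  have "Polynomial.degree q \<le> m"
    unfolding q_def
    by (intro order.trans[OF degree_smult_le]) (simp add: degree_higher_pderiv degree_power_eq)
  then have "(pderiv ^^ n) q = 0"
    using assms by (intro poly_eqI) (simp add: coeff_higher_pderiv coeff_eq_0)
  then have "integral {-1..1} (poly (q * (pderiv ^^ n) (legendre_base n))) = 0"
    by (simp add: integral_mult_higher_pderiv_legendre_base poly_0[abs_def])
  moreover have "(\<lambda>x. legendre_P m x * legendre_P n x) =
      (\<lambda>x. c * poly (q * (pderiv ^^ n) (legendre_base n)) x)"
    by (simp add: legendre_P_eq_poly q_def c_def fun_eq_iff mult_ac)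
  ultimately show ?thesis by (simp del: poly_mult)
qed

lemma legendre_orthogonal:
  assumes "m \<noteq> n"
  shows "integral {-1..1} (\<lambda>x. legendre_P m x * legendre_P n x) = 0"
proof (cases "m < n")
  case False
  then show ?thesis
    using legendre_orthogonal_less[of n m] assms by (simp add: mult.commute)
qed (rule legendre_orthogonal_less)

text \<open>Moving \<open>n\<close> derivatives from one factor to the other turns the latter into a
  constant, which leaves the integral of (1 - x^2)^n; the two signs (-1)^n cancel.\<close>

lemma integral_legendre_P_square:
  "integral {-1..1} (\<lambda>x. (legendre_P n x)\<^sup>2) = 2 / (2 * real n + 1)"
proof -
  let ?w = "legendre_base n" and ?c = "1 / (2 ^ n * fact n)\<^sup>2 :: real"
  have "integral {-1..1} (\<lambda>x. (legendre_P n x)\<^sup>2) =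
      ?c * integral {-1..1} (poly ((pderiv ^^ n) ?w * (pderiv ^^ n) ?w))"
    by (subst integral_mult_right[symmetric])
      (simp add: legendre_P_eq_poly power2_eq_square field_simps power_mult_distrib flip: power_add mult_2)
  also have "integral {-1..1} (poly ((pderiv ^^ n) ?w * (pderiv ^^ n) ?w)) =
      (-1) ^ n * integral {-1..1} (poly ((pderiv ^^ (2 * n)) ?w * ?w))"
    by (simp add: integral_mult_higher_pderiv_legendre_base funpow_add mult_2)
  also have "poly ((pderiv ^^ (2 * n)) ?w * ?w) = (\<lambda>x. ((-1) ^ n * fact (2 * n)) * poly ?w x)"
    by (simp add: higher_pderiv_legendre_base fun_eq_iff)
  also have "(-1) ^ n * integral {-1..1} \<dots> = fact (2 * n) * integral {-1..1} (poly ?w)"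
    by (subst integral_mult_right) (simp flip: power_add mult_2 mult.assoc)
  also have "?c * \<dots> = 2 / (2 * real n + 1)"
  proof -
    have alg: "1 / (A * F)\<^sup>2 * (G * (2 * A\<^sup>2 * F\<^sup>2 / (y * G))) = 2 / y"
      if "A > 0" "F > 0" "G > 0" "y > 0" for A F G y :: real
      using that by (simp add: power_mult_distrib)
    have "(2::real) ^ (2 * n + 1) = 2 * (2 ^ n)\<^sup>2"
      by (simp add: power_mult[symmetric] mult.commute)
    moreover have "fact (2 * n + 1) = (2 * real n + 1) * fact (2 * n)" by simp
    ultimately show ?thesis
      unfolding integral_legendre_base
      using alg[of "2 ^ n" "fact n" "fact (2 * n)" "2 * real n + 1"] by (simp only: fact_gt_zero) simp
  qed
  finally show ?thesis .
qed

lemma continuous_on_legendre_P [continuous_intros]: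
  "continuous_on A f \<Longrightarrow> continuous_on A (\<lambda>x. legendre_P n (f x))"
  unfolding legendre_P_eq_poly by (intro continuous_intros)

section \<open>Analytic continuation of the zeta-function\<close>

text \<open>Taylor's formula on the segment from \<open>x\<close> to \<open>x + 1\<close>, which
  avoids the branch cut. The exponent \<open>Re a - K - 1\<close> is at most 0, so the derivative of
  order \<open>K + 1\<close> is largest in modulus at the left end.\<close>

lemma powr_Taylor_bound:
  fixes a :: complex and x :: real
  assumes "x > 0" and "Re a \<le> real K + 1"
  shows "cmod (of_real (x + 1) powr a - (\<Sum>k\<le>K. (a gchoose k) * of_real x powr (a - of_nat k)))
    \<le> (cmod (\<Prod>j<Suc K. a - of_nat j) / fact K) * x powr (Re a - real K - 1)"
proof -
  define S where "S = complex_of_real ` {x..x+1}"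
  \<comment> \<open>\<open>f i\<close> is the \<open>i\<close>-th derivative of
    \<open>z powr a\<close>; its product divided by \<open>fact i\<close> is
    \<open>a gchoose i\<close>.\<close>
  define f :: "nat \<Rightarrow> complex \<Rightarrow> complex"
    where "f i z = (\<Prod>j<i. a - of_nat j) * z powr (a - of_nat i)" for i z
  let ?B = "cmod (\<Prod>j<Suc K. a - of_nat j) * x powr (Re a - real K - 1)"
  have "convex S"
    unfolding S_def by (intro convex_linear_image bounded_linear.linear bounded_linear_of_real) auto
  moreover have "(f i has_field_derivative f (Suc i) z) (at z within S)" if "z \<in> S" for i z
  proof -
    from that obtain t where t: "z = of_real t" "t \<in> {x..x + 1}"
      unfolding S_def by (rule imageE)
    then have "z \<notin> \<real>\<^sub>\<le>\<^sub>0" using assms by auto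
    from has_field_derivative_powr[OF this, of "a - of_nat i"]
    have "(f i has_field_derivative (\<Prod>j<i. a - of_nat j) *
        ((a - of_nat i) * z powr (a - of_nat i - 1))) (at z)"
      unfolding f_def by (rule DERIV_cmult)
    also have "(\<Prod>j<i. a - of_nat j) * ((a - of_nat i) * z powr (a - of_nat i - 1)) = f (Suc i) z"
      by (simp add: f_def algebra_simps)
    finally show ?thesis by (rule has_field_derivative_at_within)
  qed
  moreover have "cmod (f (Suc K) z) \<le> ?B" if z: "z \<in> S" for z
  proof -
    from z obtain t where t: "z = of_real t" "t \<in> {x..x + 1}"
      unfolding S_def by (rule imageE)
    have "cmod (z powr (a - of_nat (Suc K))) = t powr (Re a - real K - 1)"
      using t assms by (simp add: norm_powr_real_powr algebra_simps)
    also have "\<dots> \<le> x powr (Re a - real K - 1)"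
      using t assms by (intro powr_mono2') auto
    finally show ?thesis
      by (simp add: f_def norm_mult mult_left_mono del: prod.lessThan_Suc of_nat_Suc)
  qed
  moreover have "of_real x \<in> S" "of_real (x + 1) \<in> S"
    unfolding S_def by (rule imageI, simp)+
  ultimately have "cmod (f 0 (of_real (x + 1)) - (\<Sum>i\<le>K. f i (of_real x) *
      (of_real (x + 1) - of_real x) ^ i / fact i)) \<le>
      ?B * cmod (of_real (x + 1) - of_real x) ^ Suc K / fact K"
    by (intro complex_Taylor[of S]) auto
  then show ?thesis
    by (simp add: f_def gbinomial_prod_rev atLeast0LessThan)
qed

text \<open>Kept apart from \<open>riemann_zeta\<close>, whose defining choice is justified only
  once a continuation exists. It is evaluated only for \<open>Re s > 1\<close>, where the series
  converges.\<close>

definition dirichlet_zeta :: "complex \<Rightarrow> complex" where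
  "dirichlet_zeta s = (\<Sum>n. of_nat (Suc n) powr (- s))"

text \<open>The expansion is at the point \<open>n + 1\<close>, matching the shifted index of the Dirichlet series.\<close>

definition zeta_remainder :: "nat \<Rightarrow> complex \<Rightarrow> nat \<Rightarrow> complex" where
  "zeta_remainder K s n = of_nat (Suc (Suc n)) powr (1 - s) -
     (\<Sum>k\<le>K. ((1 - s) gchoose k) * of_nat (Suc n) powr (1 - s - of_nat k))"

lemma dirichlet_zeta_sums:
  assumes "Re s > 1"
  shows "(\<lambda>n. of_nat (Suc n) powr (- s)) sums dirichlet_zeta s"
proof -
  have "summable (\<lambda>n. real (Suc n) powr (- Re s))"
    using assms by (subst summable_Suc_iff) (simp add: summable_real_powr_iff)
  then have "summable (\<lambda>n. norm (of_nat (Suc n) powr (- s) :: complex))"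
    by (simp add: norm_powr_real_powr del: of_nat_Suc)
  then show ?thesis
    unfolding dirichlet_zeta_def by (rule summable_sums[OF summable_norm_cancel])
qed

lemma zeta_remainder_bound:
  assumes "Re s \<ge> - real K"
  shows "cmod (zeta_remainder K s n) \<le>
    (cmod (\<Prod>j<Suc K. 1 - s - of_nat j) / fact K) * real (Suc n) powr (- Re s - real K)"
proof -
  have "- Re s - real K = Re (1 - s) - real K - 1" by simp
  then show ?thesis
    using powr_Taylor_bound[of "real (Suc n)" "1 - s" K] assms
    unfolding zeta_remainder_def by (simp only:) (simp add: add_ac)
qed

text \<open>The terms are of order n^(- Re s - K), so each further Taylor order moves the half-plane
  of convergence one unit to the left.\<close>

lemma zeta_remainder_summable:
  assumes "Re s > 1 - real K"
  shows "summable (zeta_remainder K s)"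
proof (rule summable_comparison_test')
  have "summable (\<lambda>n. real (Suc n) powr (- Re s - real K))"
    using assms by (subst summable_Suc_iff) (simp add: summable_real_powr_iff)
  then show "summable (\<lambda>n. (cmod (\<Prod>j<Suc K. 1 - s - of_nat j) / fact K) * real (Suc n) powr (- Re s - real K))"
    by (rule summable_mult)
  show "norm (zeta_remainder K s n) \<le> (cmod (\<Prod>j<Suc K. 1 - s - of_nat j) / fact K) * real (Suc n) powr (- Re s - real K)"
    if "n \<ge> 0" for n
    using assms by (intro zeta_remainder_bound) simp
qed

lemma holomorphic_zeta_remainder_sum:
  "(\<lambda>s. \<Sum>n. zeta_remainder K s n) holomorphic_on {s. Re s > 1 - real K}"
proof (rule holomorphic_uniform_sequence)
  show op: "open {s. Re s > 1 - real K}" by (rule open_halfspace_Re_gt)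
  show "(\<lambda>s. \<Sum>n<N. zeta_remainder K s n) holomorphic_on {s. Re s > 1 - real K}" for N
    unfolding zeta_remainder_def gbinomial_prod_rev
    by (intro holomorphic_intros) auto
  fix z assume z: "z \<in> {s. Re s > 1 - real K}"
  obtain d where d: "d > 0" "cball z d \<subseteq> {s. Re s > 1 - real K}"
    using op z open_contains_cball by blast
  \<comment> \<open>The least real part on the disc; it is attained at \<open>z - d\<close>, so it
    still exceeds \<open>1 - K\<close>. Together with a bound \<open>C\<close> for the product
    factor it yields a majorant independent of \<open>s\<close>.\<close>
  define \<sigma> where "\<sigma> = Re z - d"
  have "z - of_real d \<in> cball z d" using d by (simp add: dist_norm)
  then have "z - of_real d \<in> {s. Re s > 1 - real K}" using d by blast
  then have \<sigma>: "\<sigma> > 1 - real K" by (simp add: \<sigma>_def)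
  have "compact ((\<lambda>s. cmod (\<Prod>j<Suc K. 1 - s - of_nat j) / fact K) ` cball z d)"
    by (intro compact_continuous_image continuous_intros) auto
  then obtain C where C: "\<And>s. s \<in> cball z d \<Longrightarrow> cmod (\<Prod>j<Suc K. 1 - s - of_nat j) / fact K \<le> C"
    by (meson bounded_imp_bdd_above bdd_above.unfold compact_imp_bounded imageI)
  have "uniform_limit (cball z d) (\<lambda>N s. \<Sum>n<N. zeta_remainder K s n)
      (\<lambda>s. \<Sum>n. zeta_remainder K s n) sequentially"
  proof (rule Weierstrass_m_test)
    show "summable (\<lambda>n. C * real (Suc n) powr (- \<sigma> - real K))"
      using \<sigma> by (intro summable_mult, subst summable_Suc_iff) (simp add: summable_real_powr_iff)
    fix n s assume s: "s \<in> cball z d"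
    have "\<bar>Re (z - s)\<bar> \<le> d"
      using s abs_Re_le_cmod[of "z - s"] by (simp add: dist_norm)
    then have "Re s \<ge> \<sigma>" by (simp add: \<sigma>_def)
    then have "real (Suc n) powr (- Re s - real K) \<le> real (Suc n) powr (- \<sigma> - real K)"
      by (intro powr_mono) auto
    moreover have "cmod (zeta_remainder K s n) \<le>
        (cmod (\<Prod>j<Suc K. 1 - s - of_nat j) / fact K) * real (Suc n) powr (- Re s - real K)"
      using \<open>Re s \<ge> \<sigma>\<close> \<sigma> by (intro zeta_remainder_bound) simp
    moreover have "0 \<le> C" using C[OF s] by (rule order.trans[rotated]) simp
    ultimately show "cmod (zeta_remainder K s n) \<le> C * real (Suc n) powr (- \<sigma> - real K)"
      using mult_mono[OF C[OF s]] by (smt (verit) powr_ge_zero)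
  qed
  then show "\<exists>d>0. cball z d \<subseteq> {s. Re s > 1 - real K} \<and>
      uniform_limit (cball z d) (\<lambda>N s. \<Sum>n<N. zeta_remainder K s n)
      (\<lambda>s. \<Sum>n. zeta_remainder K s n) sequentially"
    using d by blast
qed

text \<open>
  Since \<open>(1 - s) gchoose (j + 1)\<close> contains the factor \<open>s + j - 1\<close>, the right-hand side involves only
  shifts of \<open>(s - 1) \<zeta>(s)\<close>, so that no poles enter the induction below.
\<close>

lemma dirichlet_zeta_recurrence:
  assumes "Re s > 1" and "K \<ge> 1"
  shows "(s - 1) * dirichlet_zeta s = 1 + (\<Sum>n. zeta_remainder K s n) -
    (\<Sum>j=1..<K. ((1 - s) gchoose j) / of_nat (Suc j) *
      ((s + of_nat j - 1) * dirichlet_zeta (s + of_nat j)))"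
proof -
  let ?Y = "\<lambda>j. ((1 - s) gchoose j) / of_nat (Suc j) *
      ((s + of_nat j - 1) * dirichlet_zeta (s + of_nat j))"
  have "((\<lambda>n. real (Suc n) powr (1 - Re s)) \<longlongrightarrow> 0) sequentially"
    using assms by real_asymp
  then have "((\<lambda>n. of_nat (Suc n) powr (1 - s) :: complex) \<longlongrightarrow> 0) sequentially"
    by (intro tendsto_norm_zero_cancel[where f = "\<lambda>n. of_nat (Suc n) powr (1 - s)"])
      (simp add: norm_powr_real_powr del: of_nat_Suc)
  \<comment> \<open>The sum telescopes to -1, because 1 powr (1 - s) = 1.\<close>
  then have tel: "(\<lambda>n. of_nat (Suc (Suc n)) powr (1 - s) - of_nat (Suc n) powr (1 - s) :: complex)
      sums (0 - of_nat (Suc 0) powr (1 - s))"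
    by (rule telescope_sums)
  have coeff: "((1 - s) gchoose Suc j) * dirichlet_zeta (s + of_nat j) = - ?Y j" for j
  proof -
    have "((1 - s) gchoose Suc j) = ((1 - s) gchoose j) / of_nat (Suc j) * - (s + of_nat j - 1)"
      by (simp add: gbinomial_prod_rev mult_ac diff_diff_eq)
    then show ?thesis by (simp only: mult.assoc mult_minus_left mult_minus_right)
  qed
  have "(\<lambda>n. ((1 - s) gchoose Suc j) * of_nat (Suc n) powr (1 - s - of_nat (Suc j))) sums - ?Y j" for j
  proof -
    have "(\<lambda>n. of_nat (Suc n) powr - (s + of_nat j)) sums dirichlet_zeta (s + of_nat j)"
      using assms by (intro dirichlet_zeta_sums) simp
    moreover have "- (s + of_nat j) = 1 - s - of_nat (Suc j)" by simp
    ultimately show ?thesis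
      unfolding coeff[symmetric] by (metis sums_mult)
  qed
  then have "(\<lambda>n. \<Sum>j<K. ((1 - s) gchoose Suc j) * of_nat (Suc n) powr (1 - s - of_nat (Suc j)))
      sums (\<Sum>j<K. - ?Y j)"
    by (intro sums_sum)
  \<comment> \<open>The Taylor term \<open>k = 0\<close> belongs to the telescoping part; the term
    \<open>k = j + 1\<close> sums to a multiple of the zeta-function at
    \<open>s + j\<close>.\<close>
  from sums_diff[OF tel this]
  have "zeta_remainder K s sums (- 1 + (\<Sum>j<K. ?Y j))"
    by (simp add: zeta_remainder_def[abs_def] sum.atMost_shift diff_diff_eq sum_negf del: of_nat_Suc)
      simp
  \<comment> \<open>\<open>?Y 0\<close> is \<open>(s - 1) * dirichlet_zeta s\<close> itself, for
    which the equation is solved.\<close>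
  moreover have "(\<Sum>j<K. ?Y j) = ?Y 0 + (\<Sum>j=1..<K. ?Y j)"
    using assms by (simp add: sum.atLeast_Suc_lessThan flip: atLeast0LessThan del: of_nat_Suc)
  ultimately show ?thesis
    by (simp add: sums_iff)
qed

section \<open>Continuation of (s - 1) zeta(s) to the whole plane\<close>

text \<open>The recurrence serves as a definition one unit further to the left, since its right-hand
  side evaluates the function only at \<open>s + j\<close> with \<open>j \<ge> 1\<close>. For
  \<open>N = 0\<close> no shifted terms occur.\<close>

lemma zeta_continuation_half_plane:
  "\<exists>Z. Z holomorphic_on {s. Re s > - real N} \<and>
     (\<forall>s. Re s > 1 \<longrightarrow> Z s = (s - 1) * dirichlet_zeta s)"
proof (induction N)
  case 0
  have "\<forall>s. Re s > 1 \<longrightarrow> 1 + (\<Sum>n. zeta_remainder 1 s n) = (s - 1) * dirichlet_zeta s"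
    using dirichlet_zeta_recurrence[of _ 1] by simp
  moreover have "(\<lambda>s. 1 + (\<Sum>n. zeta_remainder 1 s n)) holomorphic_on {s. Re s > - real 0}"
    using holomorphic_zeta_remainder_sum[of 1] by (intro holomorphic_intros) simp
  ultimately show ?case by blast
next
  case (Suc N)
  then obtain Z where Z: "Z holomorphic_on {s. Re s > - real N}"
    "\<And>s. Re s > 1 \<Longrightarrow> Z s = (s - 1) * dirichlet_zeta s" by blast
  \<comment> \<open>With this order the remainder sum is holomorphic for Re s > 1 - K = - (N +
    1).\<close>
  define K where "K = N + 2"
  define W where "W s = 1 + (\<Sum>n. zeta_remainder K s n) -
    (\<Sum>j=1..<K. ((1 - s) gchoose j) / of_nat (Suc j) * Z (s + of_nat j))" for s
  have "W s = (s - 1) * dirichlet_zeta s" if "Re s > 1" for s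
    using dirichlet_zeta_recurrence[OF that, of K] that
    by (simp add: W_def K_def Z(2) del: of_nat_Suc)
  moreover have "W holomorphic_on {s. Re s > - real (Suc N)}"
  proof -
    have "(\<lambda>s. Z (s + of_nat j)) holomorphic_on {s. Re s > - real (Suc N)}" if "j \<in> {1..<K}" for j
      using that
      by (intro holomorphic_on_compose[OF _ holomorphic_on_subset[OF Z(1)], unfolded o_def] holomorphic_intros)
        auto
    moreover have "(\<lambda>s. \<Sum>n. zeta_remainder K s n) holomorphic_on {s. Re s > - real (Suc N)}"
      by (rule holomorphic_on_subset[OF holomorphic_zeta_remainder_sum]) (auto simp: K_def)
    ultimately show ?thesis
      unfolding W_def gbinomial_prod_rev
      by (intro holomorphic_intros) auto
  qed
  ultimately show ?case by blast
qed

text \<open>The continuations to the half-planes agree on overlaps by the identity theorem and are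
  glued together.\<close>

lemma zeta_continuation_entire:
  "\<exists>Z. Z holomorphic_on UNIV \<and> (\<forall>s. Re s > 1 \<longrightarrow> Z s = (s - 1) * dirichlet_zeta s)"
proof -
  define H where "H N = {s. Re s > - real N}" for N
  obtain Z where Z: "\<And>N. Z N holomorphic_on H N"
    "\<And>N s. Re s > 1 \<Longrightarrow> Z N s = (s - 1) * dirichlet_zeta s"
    using zeta_continuation_half_plane unfolding H_def by metis
  have op: "open (H N)" for N unfolding H_def by (rule open_halfspace_Re_gt)
  have agree: "Z M s = Z N s" if "s \<in> H M" "M \<le> N" for M N s
  proof (rule analytic_continuation_open[of "{s. Re s > 1}" "H M" "Z M" "Z N"])
    show "connected (H M)" unfolding H_def by (intro convex_connected convex_halfspace_Re_gt)
    show "Z N holomorphic_on H M"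
      using \<open>M \<le> N\<close> by (intro holomorphic_on_subset[OF Z(1)]) (auto simp: H_def)
    have "2 \<in> {s. Re s > 1}" by simp
    then show "{s. Re s > 1} \<noteq> {}" by blast
    show "{s. Re s > 1} \<subseteq> H M" by (auto simp: H_def)
  qed (use Z that op open_halfspace_Re_gt in auto)
  \<comment> \<open>The index is chosen larger than \<open>- Re s\<close>, so that \<open>s\<close>
    lies in the corresponding half-plane.\<close>
  define W where "W s = Z (nat \<lceil>- Re s\<rceil> + 1) s" for s
  have in_H: "s \<in> H (nat \<lceil>- Re s\<rceil> + 1)" for s
    unfolding H_def mem_Collect_eq by linarith
  have W_eq: "W s = Z N s" if "s \<in> H N" for N s
    unfolding W_def using agree[OF in_H, of s N] agree[OF that, of "nat \<lceil>- Re s\<rceil> + 1"]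
    by (metis nle_le)
  have "W holomorphic_on (\<Union>N. H N)"
  proof (intro holomorphic_on_UN_open op)
    show "W holomorphic_on H N" for N
      using Z(1)[of N] W_eq by (simp cong: holomorphic_cong)
  qed
  moreover have "(\<Union>N. H N) = UNIV" using in_H by blast
  ultimately have "W holomorphic_on UNIV" by simp
  moreover have "W s = (s - 1) * dirichlet_zeta s" if "Re s > 1" for s
    using that Z(2) by (simp add: W_def)
  ultimately show ?thesis by blast
qed

text \<open>Dividing the entire function by \<open>s - 1\<close> gives a witness, so the choice in
  \<open>riemann_zeta_def\<close> has its specified properties.\<close>

lemma riemann_zeta_holomorphic: "riemann_zeta holomorphic_on - {1}"
  and riemann_zeta_sums: "Re s > 1 \<Longrightarrow> (\<lambda>n. of_nat (Suc n) powr (- s)) sums riemann_zeta s"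
proof -
  obtain Z where Z: "Z holomorphic_on UNIV" "\<And>s. Re s > 1 \<Longrightarrow> Z s = (s - 1) * dirichlet_zeta s"
    using zeta_continuation_entire by blast
  have "(\<lambda>s. Z s / (s - 1)) holomorphic_on - {1}"
    by (intro holomorphic_intros holomorphic_on_subset[OF Z(1)]) auto
  moreover have "(\<lambda>n. of_nat (Suc n) powr (- s)) sums (Z s / (s - 1))" if "Re s > 1" for s
  proof -
    have "s \<noteq> 1" using that by auto
    then show ?thesis using dirichlet_zeta_sums[OF that] Z(2)[OF that] by simp
  qed
  ultimately have "\<exists>f. f holomorphic_on - {1} \<and>
      (\<forall>s. Re s > 1 \<longrightarrow> (\<lambda>n. of_nat (Suc n) powr (- s)) sums f s)"
    by blast
  from someI_ex[OF this]
  show "riemann_zeta holomorphic_on - {1}"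
    and "Re s > 1 \<Longrightarrow> (\<lambda>n. of_nat (Suc n) powr (- s)) sums riemann_zeta s"
    unfolding riemann_zeta_def by blast+
qed

section \<open>The sign of zeta(1/2)\<close>

text \<open>For \<open>Re s > 1\<close> this is the recurrence with \<open>K = 1\<close>. The
  punctured half-plane is connected, so the identity theorem extends it to a series that can be
  estimated at 1/2.\<close>

lemma riemann_zeta_critical_strip:
  assumes "Re s > 0" "s \<noteq> 1"
  shows "(s - 1) * riemann_zeta s = 1 + (\<Sum>n. zeta_remainder 1 s n)"
proof (rule analytic_continuation_open[of "{s. Re s > 1}" "{s. Re s > 0} - {1}"
      "\<lambda>s. (s - 1) * riemann_zeta s" "\<lambda>s. 1 + (\<Sum>n. zeta_remainder 1 s n)"])
  show "open {s. Re s > 1}" by (rule open_halfspace_Re_gt)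
  show "open ({s. Re s > 0} - {1})" by (intro open_Diff open_halfspace_Re_gt) auto
  show "connected ({s. Re s > 0} - {1})"
    by (intro connected_open_delete open_halfspace_Re_gt convex_connected convex_halfspace_Re_gt) simp
  have "2 \<in> {s. Re s > 1}" by simp
  then show "{s. Re s > 1} \<noteq> {}" by blast
  show "(\<lambda>s. (s - 1) * riemann_zeta s) holomorphic_on {s. Re s > 0} - {1}"
    by (intro holomorphic_intros holomorphic_on_subset[OF riemann_zeta_holomorphic]) auto
  show "(\<lambda>s. 1 + (\<Sum>n. zeta_remainder 1 s n)) holomorphic_on {s. Re s > 0} - {1}"
    using holomorphic_zeta_remainder_sum[of 1]
    by (intro holomorphic_intros) (auto elim: holomorphic_on_subset)
  show "(s - 1) * riemann_zeta s = 1 + (\<Sum>n. zeta_remainder 1 s n)" if "s \<in> {s. Re s > 1}" for s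
    using dirichlet_zeta_recurrence[of s 1] riemann_zeta_sums[of s] dirichlet_zeta_sums[of s] that
    by (simp add: sums_iff)
qed (use assms in auto)

text \<open>At 1/2 the left-hand side of the previous formula is - zeta(1/2) / 2, while the
  remainders sum to at least -1/2; hence the right-hand side has real part at least 1/2.\<close>

lemma Re_riemann_zeta_half_neg: "Re (riemann_zeta (1 / 2)) < 0"
proof -
  let ?r = "\<lambda>n. sqrt (real (Suc (Suc n))) - sqrt (real (Suc n)) - 1 / (2 * sqrt (real (Suc n)))"
  have r: "Re (zeta_remainder 1 (1 / 2) n) = ?r n" for n
  proof -
    have p: "of_nat m powr (1 / 2 :: complex) = of_real (sqrt (real m))" for m
      using powr_of_real[of "real m" "1 / 2"] by (simp add: powr_half_sqrt)
    have q: "of_nat m powr (- (1 / 2) :: complex) = of_real (inverse (sqrt (real m)))" for m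
      by (simp only: powr_minus p of_real_inverse)
    have "zeta_remainder 1 (1 / 2) n = of_nat (Suc (Suc n)) powr (1 / 2) -
        (of_nat (Suc n) powr (1 / 2) + 1 / 2 * of_nat (Suc n) powr (- (1 / 2)))"
      unfolding zeta_remainder_def by (simp del: of_nat_Suc) (simp del: of_nat_Suc add: of_nat_Suc[of 0])
    also have "\<dots> = of_real (?r n)"
      unfolding p q by (simp only: of_real_diff of_real_add of_real_mult of_real_divide of_real_inverse
          of_real_1 of_real_numeral) (simp only: divide_inverse inverse_mult_distrib mult_1 diff_diff_eq)
    finally show ?thesis by (simp only: Re_complex_of_real)
  qed
  have "summable (zeta_remainder 1 (1 / 2))"
    by (rule zeta_remainder_summable) simp
  from sums_Re[OF summable_sums[OF this]]
  have sr: "?r sums Re (\<Sum>n. zeta_remainder 1 (1 / 2) n)" by (simp only: r)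
  \<comment> \<open>Comparison series: the differences of 1 / (2 sqrt(n+1)) telescope to -1/2 and
    are termwise below the remainders.\<close>
  have "(\<lambda>n. 1 / (2 * sqrt (real (Suc n)))) \<longlonglongrightarrow> 0" by real_asymp
  from telescope_sums[OF this]
  have tel: "(\<lambda>n. 1 / (2 * sqrt (real (Suc (Suc n)))) - 1 / (2 * sqrt (real (Suc n)))) sums - (1 / 2)" by simp
  have "- (1 / 2) \<le> Re (\<Sum>n. zeta_remainder 1 (1 / 2) n)"
  proof (rule sums_le[OF _ tel sr])
    fix n
    define u v where "u = sqrt (real (Suc n))" and "v = sqrt (real (Suc (Suc n)))"
    have u: "u > 0" "u < v" "v\<^sup>2 = u\<^sup>2 + 1" by (auto simp: u_def v_def)
    have "(v - u) * (v + u) = 1" using u(3) by (simp add: algebra_simps power2_eq_square)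
    \<comment> \<open>After rationalising, the termwise comparison becomes 1 / (v + u) \<ge> 1 /
      (2v), that is, \<open>u \<le> v\<close>.\<close>
    then have "v - u = 1 / (v + u)" using u by (simp add: field_simps)
    then have "v - u - 1 / (2 * u) - (1 / (2 * v) - 1 / (2 * u)) = 1 / (v + u) - 1 / (2 * v)" by simp
    also have "\<dots> \<ge> 0" using u by (simp add: field_simps)
    finally show "1 / (2 * sqrt (real (Suc (Suc n)))) - 1 / (2 * sqrt (real (Suc n))) \<le> ?r n"
      unfolding u_def v_def by linarith
  qed
  moreover have "(1 / 2 - 1) * riemann_zeta (1 / 2) = 1 + (\<Sum>n. zeta_remainder 1 (1 / 2) n)"
    by (rule riemann_zeta_critical_strip) auto
  then have "Re ((1 / 2 - 1) * riemann_zeta (1 / 2)) = 1 + Re (\<Sum>n. zeta_remainder 1 (1 / 2) n)" by simp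
  moreover have "Re ((1 / 2 - 1) * riemann_zeta (1 / 2)) = - (Re (riemann_zeta (1 / 2)) / 2)"
    by (simp)
  ultimately show ?thesis by linarith
qed

section \<open>Hardy's function\<close>

text \<open>The reflections \<open>cnj \<circ> f \<circ> cnj\<close> turn \<open>Im\<close> and \<open>Re\<close> on the real line into holomorphic expressions.\<close>

lemma hardy_Z_holomorphic_extension:
  obtains G where "G holomorphic_on {w. \<bar>Im w\<bar> < 1 / 2}"
    and "\<And>t. G (of_real t) = of_real (hardy_Z t)"
proof -
  \<comment> \<open>In this strip 1/4 + i w/2 has positive real part, and 1/2 + i w avoids the pole
    at 1, which would require Im w = -1/2. The strip is closed under conjugation.\<close>
  define S where "S = {w. \<bar>Im w\<bar> < 1 / 2}"
  have S_eq: "S = {w. Im w > - (1 / 2)} \<inter> {w. Im w < 1 / 2}"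
    by (auto simp: S_def)
  have "open S"
    unfolding S_eq by (intro open_Int open_halfspace_Im_gt open_halfspace_Im_lt)
  have cnj_S: "cnj ` S = S"
  proof -
    have "w \<in> cnj ` S" if "w \<in> S" for w
      using that by (intro image_eqI[of _ _ "cnj w"]) (auto simp: S_def)
    then show ?thesis by (auto simp: S_def)
  qed
  define L where "L w = ln_Gamma (1 / 4 + \<i> * (w / 2))" for w
  \<comment> \<open>On the real axis the difference quotient by 2i is the imaginary part of
    \<open>ln_Gamma\<close>, so \<open>h\<close> restricts to the complex product whose real part
    defines \<open>hardy_Z\<close>.\<close>
  define h where "h w = exp (\<i> * (- (w / 2) * of_real (ln pi) + (L w - (cnj \<circ> L \<circ> cnj) w) / (2 * \<i>))) *
      riemann_zeta (1 / 2 + \<i> * w)" for w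
  have L: "L holomorphic_on S"
    unfolding L_def
  proof (intro holomorphic_on_compose[OF _ holomorphic_ln_Gamma, unfolded o_def] holomorphic_intros)
    show "(\<lambda>w. 1 / 4 + \<i> * (w / 2)) ` S \<inter> \<real>\<^sub>\<le>\<^sub>0 = {}"
      by (auto simp: S_def complex_nonpos_Reals_iff)
  qed auto
  have "(cnj \<circ> L \<circ> cnj) holomorphic_on S"
    using L \<open>open S\<close> by (intro holomorphic_on_compose_cnj_cnj) (simp_all add: cnj_S)
  moreover have "(\<lambda>w. riemann_zeta (1 / 2 + \<i> * w)) holomorphic_on S"
  proof (intro holomorphic_on_compose[OF _ holomorphic_on_subset[OF riemann_zeta_holomorphic], unfolded o_def]
      holomorphic_intros)
    show "(\<lambda>w. 1 / 2 + \<i> * w) ` S \<subseteq> - {1}"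
      by (auto simp: S_def complex_eq_iff)
  qed
  ultimately have "h holomorphic_on S"
    unfolding h_def o_def using L by (intro holomorphic_intros) (simp_all add: o_def)
  moreover from this have "(cnj \<circ> h \<circ> cnj) holomorphic_on S"
    using \<open>open S\<close> by (intro holomorphic_on_compose_cnj_cnj) (simp_all add: cnj_S)
  ultimately have "(\<lambda>w. (h w + (cnj \<circ> h \<circ> cnj) w) / 2) holomorphic_on S"
    unfolding o_def by (intro holomorphic_intros) (simp_all add: o_def)
  moreover have "(h (of_real t) + (cnj \<circ> h \<circ> cnj) (of_real t)) / 2 = of_real (hardy_Z t)" for t
  proof -
    have "(L (of_real t) - (cnj \<circ> L \<circ> cnj) (of_real t)) / (2 * \<i>) = of_real (Im (L (of_real t)))"
      by (simp add: complex_diff_cnj complex_eq_iff)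
    then have "h (of_real t) = exp (\<i> * of_real (hardy_theta t)) * riemann_zeta (1 / 2 + \<i> * of_real t)"
      by (simp add: h_def hardy_theta_def L_def)
    then have "hardy_Z t = Re (h (of_real t))" by (simp only: hardy_Z_def)
    then show ?thesis by (simp add: complex_add_cnj)
  qed
  ultimately show ?thesis
    using that unfolding S_def by blast
qed

lemma continuous_on_hardy_Z: "continuous_on A hardy_Z"
proof -
  obtain G where G: "G holomorphic_on {w. \<bar>Im w\<bar> < 1 / 2}"
    and eq: "\<And>t. G (of_real t) = of_real (hardy_Z t)"
    using hardy_Z_holomorphic_extension by blast
  have "continuous_on A (\<lambda>t. Re (G (of_real t)))"
    by (intro continuous_on_Re continuous_on_compose2[OF holomorphic_on_imp_continuous_on[OF G]]
        continuous_intros) auto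
  then show ?thesis by (simp add: eq)
qed

lemma hardy_Z_0_neg: "hardy_Z 0 < 0"
proof -
  have "ln_Gamma (1 / 4 :: complex) = of_real (ln_Gamma (1 / 4))"
    using ln_Gamma_complex_of_real[of "1 / 4"] by simp
  then have "hardy_theta 0 = 0" by (simp add: hardy_theta_def)
  then show ?thesis
    using Re_riemann_zeta_half_neg by (simp add: hardy_Z_def)
qed

text \<open>If Z vanished on an interval, zeros of its extension would accumulate at the midpoint.
  The extension would then vanish on the connected strip, contradicting the sign at 0.\<close>

lemma hardy_Z_nonzero_in_interval:
  assumes "a < b"
  shows "\<exists>t\<in>{a<..<b}. hardy_Z t \<noteq> 0"
proof (rule ccontr)
  assume zero: "\<not> (\<exists>t\<in>{a<..<b}. hardy_Z t \<noteq> 0)"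
  define S where "S = {w. \<bar>Im w\<bar> < 1 / 2}"
  have S_eq: "S = {w. Im w > - (1 / 2)} \<inter> {w. Im w < 1 / 2}"
    by (auto simp: S_def)
  obtain G where G: "G holomorphic_on S" and eq: "\<And>t. G (of_real t) = of_real (hardy_Z t)"
    using hardy_Z_holomorphic_extension unfolding S_def by blast
  let ?m = "(a + b) / 2" and ?U = "complex_of_real ` {a<..<b}"
  have "complex_of_real ?m islimpt ?U"
  proof (rule islimpt_approachable[THEN iffD2], intro allI impI)
    fix e :: real assume "e > 0"
    define d where "d = min e (b - a) / 4"
    have d: "d > 0" "d < e" "?m + d < b" "?m + d > a"
      using \<open>e > 0\<close> assms by (auto simp: d_def min_def field_simps)
    have "complex_of_real (?m + d) \<in> ?U" by (rule imageI) (use d in simp)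
    moreover have "complex_of_real (?m + d) \<noteq> of_real ?m" using d(1) by (simp only: of_real_eq_iff)
    moreover have "dist (complex_of_real (?m + d)) (of_real ?m) < e"
      using d by (simp add: dist_norm del: of_real_divide of_real_add flip: of_real_diff)
    ultimately show "\<exists>x'\<in>?U. x' \<noteq> of_real ?m \<and> dist x' (of_real ?m) < e" by blast
  qed
  then have "G 0 = 0"
  proof (rule analytic_continuation[OF G, rotated 4])
    show "open S"
      unfolding S_eq by (intro open_Int open_halfspace_Im_gt open_halfspace_Im_lt)
    show "connected S"
      unfolding S_eq by (intro convex_connected convex_Int convex_halfspace_Im_gt convex_halfspace_Im_lt)
    show "G z = 0" if "z \<in> ?U" for z
      using that zero by (auto simp: eq)
  qed (auto simp: S_def)
  then show False
    using eq[of 0] hardy_Z_0_neg by simp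
qed

section \<open>Jacob's ladders\<close>

lemma integral_pos_continuous:
  fixes f :: "real \<Rightarrow> real"
  assumes "continuous_on {a..b} f" and "\<And>x. x \<in> {a..b} \<Longrightarrow> f x \<ge> 0"
    and "\<exists>x\<in>{a<..<b}. f x \<noteq> 0"
  shows "integral {a..b} f > 0"
proof -
  obtain x where x: "x \<in> {a<..<b}" "f x \<noteq> 0" using assms(3) by blast
  then have "integral {a..b} f \<noteq> 0"
    using integral_eq_0_iff[of a b f] assms(1,2) by fastforce
  moreover have "integral {a..b} f \<ge> 0"
    using assms by (intro integral_nonneg integrable_continuous_real)
  ultimately show ?thesis by simp
qed

section \<open>Monotonicity and unboundedness of the ladder\<close>

text \<open>\<open>h\<close> stands for Z^2. The analytic input from the zeta-function enters as
  continuity, nonnegativity and not vanishing on any interval.\<close>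

locale ladder =
  fixes h \<mu> \<phi> :: "real \<Rightarrow> real" and y\<^sub>0 t\<^sub>0 :: real
  assumes scale: "ladder_scale y\<^sub>0 \<mu>"
    and h_cont: "\<And>A. continuous_on A h"
    and h_nonneg: "\<And>t. h t \<ge> 0"
    and h_nonzero: "\<And>a b. a < b \<Longrightarrow> \<exists>t\<in>{a<..<b}. h t \<noteq> 0"
    and t\<^sub>0_pos: "0 < t\<^sub>0"
    and \<phi>_ge: "\<And>T. T \<ge> t\<^sub>0 \<Longrightarrow> \<phi> T \<ge> y\<^sub>0"
    and \<phi>_eq: "\<And>T. T \<ge> t\<^sub>0 \<Longrightarrow>
      integral {0..\<mu> (\<phi> T)} (\<lambda>t. h t * exp (- (2 / \<phi> T) * t)) = integral {0..T} h"
begin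

definition F :: "real \<Rightarrow> real" where "F T = integral {0..T} h"

definition \<Phi> :: "real \<Rightarrow> real" where
  "\<Phi> y = integral {0..\<mu> y} (\<lambda>t. h t * exp (- (2 / y) * t))"

lemma \<Phi>_\<phi>: "T \<ge> t\<^sub>0 \<Longrightarrow> \<Phi> (\<phi> T) = F T"
  using \<phi>_eq by (simp add: \<Phi>_def F_def)

lemma y\<^sub>0_pos: "0 < y\<^sub>0" and \<mu>_mono: "mono_on {y\<^sub>0..} \<mu>"
  using scale by (auto simp: ladder_scale_def)

text \<open>To the right of \<open>y\<^sub>0\<close> the derivative within the half-line is an
  ordinary one, and it is nonnegative by monotonicity.\<close>

lemma \<mu>_deriv:
  assumes "y > y\<^sub>0"
  obtains D where "(\<mu> has_real_derivative D) (at y)" "D \<ge> 0"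
proof -
  obtain D where "D 0 = \<mu>"
    "\<And>n y. y \<ge> y\<^sub>0 \<Longrightarrow> (D n has_real_derivative D (Suc n) y) (at y within {y\<^sub>0..})"
    using scale unfolding ladder_scale_def by metis
  then have "(\<mu> has_real_derivative D 1 y) (at y within {y\<^sub>0..})"
    using assms by (metis One_nat_def less_imp_le)
  then have "(\<mu> has_real_derivative D 1 y) (at y)"
    using assms by (simp only: at_within_interior[of y "{y\<^sub>0..}"] interior_real_atLeast greaterThan_iff)
  moreover from this have "D 1 y \<ge> 0"
    using assms by (intro mono_on_imp_deriv_nonneg[OF \<mu>_mono]) simp_all
  ultimately show ?thesis using that by blast
qed

lemma weighted_cont: "continuous_on A (\<lambda>t. h t * exp (c * t))"
  by (intro continuous_intros h_cont)

lemma weighted_integrable: "(\<lambda>t. h t * exp (c * t)) integrable_on {a..b}"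
  by (intro integrable_continuous_real weighted_cont)

lemma h_integrable: "h integrable_on {a..b}"
  by (intro integrable_continuous_real h_cont)

text \<open>Positivity of \<open>w\<close> is asked only in the interior because several weights
  below vanish at 0.\<close>

lemma integral_h_weight_pos:
  assumes "a < b" "continuous_on {a..b} w" "\<And>t. t \<in> {a..b} \<Longrightarrow> w t \<ge> 0" "\<And>t. t \<in> {a<..<b} \<Longrightarrow> w t > 0"
  shows "integral {a..b} (\<lambda>t. h t * w t) > 0"
proof (rule integral_pos_continuous)
  show "continuous_on {a..b} (\<lambda>t. h t * w t)"
    by (intro continuous_intros h_cont assms)
  show "\<exists>t\<in>{a<..<b}. h t * w t \<noteq> 0"
    using h_nonzero[OF assms(1)] assms(4) by fastforce
qed (use assms h_nonneg in auto)

lemma F_strict_mono: "0 \<le> s \<Longrightarrow> s < t \<Longrightarrow> F s < F t"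
  using Henstock_Kurzweil_Integration.integral_combine[of 0 s t h] h_integrable[of 0 t]
    integral_h_weight_pos[of s t "\<lambda>_. 1"]
  by (simp add: F_def)

text \<open>Both the integrand and the range of integration grow with \<open>y\<close>. Strictness
  comes from the integrand, as \<open>\<mu>\<close> may be locally constant.\<close>

lemma \<Phi>_strict_mono:
  assumes "y\<^sub>0 \<le> y" "y < z" "\<mu> y > 0"
  shows "\<Phi> y < \<Phi> z"
proof -
  have pos: "0 < y" "0 < z" using y\<^sub>0_pos assms by auto
  have "\<mu> y \<le> \<mu> z"
    using assms by (intro mono_onD[OF \<mu>_mono]) auto
  have "0 < integral {0..\<mu> y} (\<lambda>t. h t * (exp (- (2 / z) * t) - exp (- (2 / y) * t)))"
  proof (rule integral_h_weight_pos)
    show "exp (- (2 / z) * t) - exp (- (2 / y) * t) > 0" if "t \<in> {0<..<\<mu> y}" for t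
      using that assms pos by (auto intro!: mult_strict_right_mono divide_strict_left_mono)
    show "exp (- (2 / z) * t) - exp (- (2 / y) * t) \<ge> 0" if "t \<in> {0..\<mu> y}" for t
      using that assms pos by (auto intro!: mult_right_mono divide_left_mono)
  qed (use assms pos in \<open>auto intro!: continuous_intros\<close>)
  also have "\<dots> = integral {0..\<mu> y} (\<lambda>t. h t * exp (- (2 / z) * t)) - \<Phi> y"
    unfolding right_diff_distrib \<Phi>_def by (intro integral_diff weighted_integrable)
  also have "integral {0..\<mu> y} (\<lambda>t. h t * exp (- (2 / z) * t)) \<le> \<Phi> z"
    unfolding \<Phi>_def using \<open>\<mu> y \<le> \<mu> z\<close> h_nonneg
    by (intro integral_subset_le weighted_integrable) auto
  finally show ?thesis by simp
qed

lemma \<Phi>_less_F: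
  assumes "y\<^sub>0 \<le> y" "\<mu> y > 0"
  shows "\<Phi> y < F (\<mu> y)"
proof -
  have "0 < integral {0..\<mu> y} (\<lambda>t. h t * (1 - exp (- (2 / y) * t)))"
    by (rule integral_h_weight_pos)
      (use assms y\<^sub>0_pos in \<open>auto intro!: continuous_intros divide_nonneg_nonneg\<close>)
  also have "\<dots> = F (\<mu> y) - \<Phi> y"
    unfolding right_diff_distrib \<Phi>_def F_def mult_1_right
    by (intro integral_diff weighted_integrable h_integrable)
  finally show ?thesis by simp
qed

text \<open>Otherwise the integral defining \<open>\<Phi>\<close> runs over an empty or one-point
  interval and is 0, while \<open>F T > 0\<close>.\<close>

lemma \<mu>_\<phi>_pos:
  assumes "T \<ge> t\<^sub>0"
  shows "\<mu> (\<phi> T) > 0"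
proof (rule ccontr)
  assume "\<not> \<mu> (\<phi> T) > 0"
  then have "\<Phi> (\<phi> T) = 0" by (cases "\<mu> (\<phi> T) = 0") (auto simp: \<Phi>_def)
  moreover have "F T > 0"
    using F_strict_mono[of 0 T] t\<^sub>0_pos assms by (simp add: F_def)
  ultimately show False using \<Phi>_\<phi> assms by simp
qed

lemma \<phi>_strict_mono:
  assumes "t\<^sub>0 \<le> s" "s < t"
  shows "\<phi> s < \<phi> t"
proof (rule ccontr)
  assume "\<not> \<phi> s < \<phi> t"
  then have "\<Phi> (\<phi> t) \<le> \<Phi> (\<phi> s)"
    using \<Phi>_strict_mono[of "\<phi> t" "\<phi> s"] \<phi>_ge[of t] \<mu>_\<phi>_pos[of t] assms
    by (cases "\<phi> s = \<phi> t") auto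
  then show False
    using F_strict_mono[of s t] \<Phi>_\<phi> assms t\<^sub>0_pos by simp
qed

text \<open>If \<open>\<phi>\<close> stayed below \<open>z\<close>, then at some T \<ge>
  \<open>\<mu> z\<close> one would have F T = \<Phi> (\<phi> T) \<le> \<Phi> z < F (\<mu> z) \<le> F
  T.\<close>

lemma \<phi>_unbounded: "\<exists>T\<ge>t\<^sub>0. \<phi> T > y"
proof (rule ccontr)
  assume "\<not> ?thesis"
  then have le: "\<phi> T \<le> y" if "T \<ge> t\<^sub>0" for T using that by force
  define z where "z = max y y\<^sub>0"
  define T where "T = max t\<^sub>0 (\<mu> z)"
  have T: "T \<ge> t\<^sub>0" "T \<ge> \<mu> z" by (auto simp: T_def)
  have z: "\<phi> T \<le> z" "y\<^sub>0 \<le> z" using le[OF T(1)] by (auto simp: z_def)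
  have "\<mu> (\<phi> T) \<le> \<mu> z"
    using z \<phi>_ge[OF T(1)] by (intro mono_onD[OF \<mu>_mono]) auto
  then have "\<mu> z > 0" using \<mu>_\<phi>_pos[OF T(1)] by simp
  have "F T = \<Phi> (\<phi> T)" using \<Phi>_\<phi> T by simp
  also have "\<dots> \<le> \<Phi> z"
    using \<Phi>_strict_mono[of "\<phi> T" z] \<phi>_ge[OF T(1)] \<mu>_\<phi>_pos[OF T(1)] z
    by (cases "\<phi> T = z") auto
  also have "\<dots> < F (\<mu> z)" using \<Phi>_less_F z \<open>\<mu> z > 0\<close> by simp
  also have "\<dots> \<le> F T"
    using F_strict_mono[of "\<mu> z" T] T \<open>\<mu> z > 0\<close> by (cases "\<mu> z = T") auto
  finally show False by simp
qed

section \<open>Differentiability of the ladder\<close>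

text \<open>In \<open>\<Phi> y\<close> the variable occurs in the exponent and in the upper limit;
  here the two roles are separated. The partial derivative in \<open>p\<close> is Leibniz's rule and
  the one in \<open>u\<close> the fundamental theorem of calculus; continuity of the latter gives
  joint differentiability.\<close>

lemma integral_h_exp_has_derivative:
  assumes "p > 0" "u > 0"
  shows "((\<lambda>(p, u). integral {0..u} (\<lambda>t. h t * exp (- (2 / p) * t))) has_derivative
    (\<lambda>(dp, du). dp * integral {0..u} (\<lambda>t. h t * (exp (- (2 / p) * t) * (2 / p\<^sup>2 * t))) +
      h u * exp (- (2 / p) * u) * du)) (at (p, u))"
proof -
  let ?X = "{0<..} :: real set"
  let ?G = "\<lambda>p u. integral {0..u} (\<lambda>t. h t * exp (- (2 / p) * t))"
  let ?fy = "\<lambda>p u. blinfun_mult_right (h u * exp (- (2 / p) * u))"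
  have "((\<lambda>(p, u). ?G p u) has_derivative
      (\<lambda>(dp, du). dp * integral {0..u} (\<lambda>t. h t * (exp (- (2 / p) * t) * (2 / p\<^sup>2 * t))) + ?fy p u du))
      (at (p, u) within ?X \<times> ?X)"
  proof (rule has_derivative_partialsI)
    have "((\<lambda>p. integral (cbox 0 u) (\<lambda>t. h t * exp (- (2 / p) * t))) has_real_derivative
        integral (cbox 0 u) (\<lambda>t. h t * (exp (- (2 / p) * t) * (2 / p\<^sup>2 * t)))) (at p within ?X)"
    proof (rule leibniz_rule_field_derivative)
      show "((\<lambda>p. h t * exp (- (2 / p) * t)) has_real_derivative
          h t * (exp (- (2 / p) * t) * (2 / p\<^sup>2 * t))) (at p within ?X)"
        if "p \<in> ?X" for p t
        using that by (auto intro!: derivative_eq_intros simp: power2_eq_square)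
      show "continuous_on (?X \<times> cbox 0 u) (\<lambda>(p, t). h t * (exp (- (2 / p) * t) * (2 / p\<^sup>2 * t)))"
        unfolding case_prod_beta
        by (intro continuous_intros continuous_on_compose2[OF h_cont]) auto
      show "(\<lambda>t. h t * exp (- (2 / p) * t)) integrable_on cbox 0 u" for p
        unfolding cbox_interval by (rule weighted_integrable)
    qed (use assms in auto)
    then show "((\<lambda>p. ?G p u) has_derivative
        (\<lambda>dp. dp * integral {0..u} (\<lambda>t. h t * (exp (- (2 / p) * t) * (2 / p\<^sup>2 * t))))) (at p within ?X)"
      unfolding cbox_interval has_field_derivative_def
      by (rule has_derivative_eq_rhs) (simp add: fun_eq_iff)
  next
    fix p u assume pu: "p \<in> ?X" "u \<in> ?X"
    \<comment> \<open>The right end \<open>u + 1\<close> makes \<open>u\<close> an interior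
      point.\<close>
    have "(?G p has_real_derivative h u * exp (- (2 / p) * u)) (at u within {0..u + 1})"
      using pu by (intro integral_has_real_derivative weighted_cont) auto
    then have "(?G p has_real_derivative h u * exp (- (2 / p) * u)) (at u)"
      using pu by (simp add: at_within_Icc_at)
    then show "(?G p has_derivative blinfun_apply (?fy p u)) (at u within ?X)"
      by (auto simp: has_field_derivative_def intro: has_derivative_at_withinI)
  next
    have "continuous_on (?X \<times> ?X) (\<lambda>(p, u). ?fy p u)"
      unfolding case_prod_beta
      by (intro continuous_intros bounded_linear.continuous_on[OF bounded_linear_blinfun_mult_right]
          continuous_on_compose2[OF h_cont]) auto
    then show "continuous (at (p, u) within ?X \<times> ?X) (\<lambda>(p, u). ?fy p u)"
      using assms by (auto simp: continuous_on_eq_continuous_within)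
  qed (use assms in auto)
  moreover have "at (p, u) within ?X \<times> ?X = at (p, u)"
    using assms by (intro at_within_open open_Times) auto
  ultimately show ?thesis by simp
qed

text \<open>Chain rule along \<open>p \<mapsto> (p, \<mu> p)\<close>. The integral over the
  parameter derivative is strictly positive; the boundary term is only nonnegative, since
  \<open>h (\<mu> y)\<close> and \<open>D\<close> may be 0.\<close>

lemma \<Phi>_deriv_pos:
  assumes "y > y\<^sub>0" "\<mu> y > 0"
  shows "\<exists>c>0. (\<Phi> has_real_derivative c) (at y)"
proof -
  obtain D where D: "(\<mu> has_real_derivative D) (at y)" "D \<ge> 0" using \<mu>_deriv assms by blast
  have "y > 0" using assms y\<^sub>0_pos by simp
  let ?I = "integral {0..\<mu> y} (\<lambda>t. h t * (exp (- (2 / y) * t) * (2 / y\<^sup>2 * t)))"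
  have "((\<lambda>p. (p, \<mu> p)) has_derivative (\<lambda>t. (t, D * t))) (at y)"
    using D(1) by (auto simp: has_field_derivative_def intro!: derivative_eq_intros)
  from has_derivative_compose[OF this integral_h_exp_has_derivative[OF \<open>y > 0\<close> assms(2)]]
  have "(\<Phi> has_derivative (\<lambda>t. t * ?I + h (\<mu> y) * exp (- (2 / y) * \<mu> y) * (D * t))) (at y)"
    by (simp add: \<Phi>_def[abs_def])
  then have "(\<Phi> has_real_derivative ?I + h (\<mu> y) * exp (- (2 / y) * \<mu> y) * D) (at y)"
    unfolding has_field_derivative_def
    by (rule has_derivative_eq_rhs) (simp add: fun_eq_iff algebra_simps)
  moreover have "?I > 0"
    using assms \<open>y > 0\<close> by (intro integral_h_weight_pos) (auto intro!: continuous_intros)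
  moreover have "h (\<mu> y) * exp (- (2 / y) * \<mu> y) * D \<ge> 0"
    using h_nonneg D(2) by simp
  ultimately show ?thesis
    by (intro exI[of _ "?I + h (\<mu> y) * exp (- (2 / y) * \<mu> y) * D"] conjI add_pos_nonneg)
qed

text \<open>Near \<open>T\<close> the ladder is a local inverse of \<open>\<Phi>\<close> composed
  with \<open>F\<close>, and the inverse function theorem applies because the derivative of
  \<open>\<Phi>\<close> is not 0.\<close>

lemma \<phi>_differentiable:
  assumes "T > t\<^sub>0"
  shows "\<exists>d. (\<phi> has_real_derivative d) (at T)"
proof -
  \<comment> \<open>An open set on which \<open>\<Phi>\<close> is injective with positive
    derivative. It contains \<open>\<phi> t\<close> for \<open>t > t\<^sub>0\<close>, because then
    \<open>\<phi> t > \<phi> t\<^sub>0 \<ge> y\<^sub>0\<close>.\<close>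
  define S where "S = {y. y > y\<^sub>0 \<and> \<mu> y > 0}"
  define g where "g = inv_into S \<Phi>"
  have \<phi>_S: "\<phi> t \<in> S" if "t > t\<^sub>0" for t
    using \<phi>_strict_mono[of t\<^sub>0 t] \<phi>_ge[of t\<^sub>0] \<mu>_\<phi>_pos[of t] that by (auto simp: S_def)
  have "inj_on \<Phi> S"
  proof (rule inj_onI)
    fix x y assume "x \<in> S" "y \<in> S" "\<Phi> x = \<Phi> y"
    then show "x = y"
      using \<Phi>_strict_mono[of x y] \<Phi>_strict_mono[of y x]
      by (cases x y rule: linorder_cases) (auto simp: S_def)
  qed
  then have g: "g (\<Phi> y) = y" if "y \<in> S" for y
    using that by (simp add: g_def)
  have "continuous_on {y\<^sub>0<..} \<mu>"
  proof (intro continuous_at_imp_continuous_on ballI)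
    fix y assume "y \<in> {y\<^sub>0<..}"
    then have "y > y\<^sub>0" by simp
    then obtain D where "(\<mu> has_real_derivative D) (at y)" by (rule \<mu>_deriv)
    then show "isCont \<mu> y" by (rule DERIV_isCont)
  qed
  then have "open ({y\<^sub>0<..} \<inter> \<mu> -` {0<..})"
    by (rule continuous_open_preimage) auto
  then have "open S"
    by (simp add: S_def Int_def vimage_def)
  have deriv: "\<exists>c>0. (\<Phi> has_real_derivative c) (at y)" if "y \<in> S" for y
    using that \<Phi>_deriv_pos by (auto simp: S_def)
  obtain c where c: "c > 0" "(\<Phi> has_real_derivative c) (at (\<phi> T))"
    using deriv[OF \<phi>_S[OF assms]] by blast
  have "continuous_on S \<Phi>"
    using deriv by (intro continuous_at_imp_continuous_on) (blast intro: DERIV_isCont)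
  then have "(g has_real_derivative inverse c) (at (\<Phi> (\<phi> T)))"
    using c \<open>open S\<close> \<phi>_S[OF assms] g
    by (intro has_field_derivative_inverse_strong[of \<Phi> c "\<phi> T" S]) auto
  moreover have "(F has_real_derivative h T) (at T)"
  proof -
    have "(F has_real_derivative h T) (at T within {0..T + 1})"
      unfolding F_def[abs_def] using assms t\<^sub>0_pos by (intro integral_has_real_derivative h_cont) auto
    then show ?thesis using assms t\<^sub>0_pos by (simp add: at_within_Icc_at)
  qed
  ultimately have "((\<lambda>t. g (F t)) has_real_derivative inverse c * h T) (at T)"
    using assms \<Phi>_\<phi> by (intro DERIV_chain2) auto
  moreover have "\<forall>\<^sub>F t in nhds T. g (F t) = \<phi> t"
    using eventually_nhds_in_open[of "{t\<^sub>0<..}" T] assms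
    by (auto elim!: eventually_mono simp flip: \<Phi>_\<phi> simp: g \<phi>_S)
  ultimately show ?thesis
    using DERIV_cong_ev[of T T "\<lambda>t. g (F t)" \<phi>] by blast
qed

section \<open>Change of variables\<close>

lemma \<phi>_substitution:
  assumes "T \<ge> \<phi> (t\<^sub>0 + 1) / 2" and f: "continuous_on {-1..1} f"
  shows "((\<lambda>t. f (\<phi> t / 2 - T - 1) * deriv (\<lambda>t. \<phi> t / 2) t) has_integral integral {-1..1} f)
    {inv_into {t\<^sub>0..} (\<lambda>t. \<phi> t / 2) T..inv_into {t\<^sub>0..} (\<lambda>t. \<phi> t / 2) (T + 2)}"
proof -
  let ?\<phi>1 = "\<lambda>t. \<phi> t / 2"
  have deriv: "(?\<phi>1 has_real_derivative deriv ?\<phi>1 t) (at t)" if "t > t\<^sub>0" for t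
  proof -
    from \<phi>_differentiable[OF that] obtain d where "(\<phi> has_real_derivative d) (at t)" by blast
    then have "(?\<phi>1 has_real_derivative d / 2) (at t)" by (rule DERIV_cdivide)
    then show ?thesis by (simp add: DERIV_imp_deriv)
  qed
  have inj: "inj_on ?\<phi>1 {t\<^sub>0..}"
    using \<phi>_strict_mono by (intro linorder_inj_onI) force+
  \<comment> \<open>The threshold at \<open>t\<^sub>0 + 1\<close> keeps preimages away from
    \<open>t\<^sub>0\<close>, where only one-sided information is available. They exist by the
    intermediate value theorem, with the upper end supplied by unboundedness.\<close>
  have inv: "\<exists>t>t\<^sub>0. inv_into {t\<^sub>0..} ?\<phi>1 U = t \<and> ?\<phi>1 t = U" if U: "U \<ge> ?\<phi>1 (t\<^sub>0 + 1)" for U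
  proof -
    obtain s where s: "s \<ge> t\<^sub>0" "\<phi> s > 2 * U" using \<phi>_unbounded by blast
    have "t\<^sub>0 + 1 \<le> s"
      using \<phi>_strict_mono[of s "t\<^sub>0 + 1"] s U by force
    moreover have "continuous_on {t\<^sub>0 + 1..s} ?\<phi>1"
      by (intro continuous_at_imp_continuous_on) (auto intro!: DERIV_isCont[OF deriv])
    ultimately obtain t where "t \<ge> t\<^sub>0 + 1" "?\<phi>1 t = U"
      using IVT'[of ?\<phi>1 "t\<^sub>0 + 1" U s] s U by auto
    then show ?thesis using inv_into_f_f[OF inj, of t] by (intro exI[of _ t]) auto
  qed
  obtain a where a: "a > t\<^sub>0" "inv_into {t\<^sub>0..} ?\<phi>1 T = a" "?\<phi>1 a = T"
    using inv[of T] assms by auto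
  obtain b where b: "b > t\<^sub>0" "inv_into {t\<^sub>0..} ?\<phi>1 (T + 2) = b" "?\<phi>1 b = T + 2"
    using inv[of "T + 2"] assms by auto
  have "a < b"
    using a b \<phi>_strict_mono[of b a] by (cases "a = b") force+
  \<comment> \<open>The shift sends the values \<open>T\<close> and \<open>T + 2\<close> at the
    endpoints to -1 and 1.\<close>
  define g where "g t = ?\<phi>1 t - T - 1" for t
  have ga: "g a = -1" "g b = 1" unfolding g_def using a(3) b(3) by linarith+
  have g: "(g has_real_derivative deriv ?\<phi>1 t) (at t)" if "t > t\<^sub>0" for t
    unfolding g_def
    by (rule DERIV_cong[OF DERIV_diff[OF DERIV_diff[OF deriv[OF that] DERIV_const] DERIV_const]]) simp
  have g_mono: "g s \<le> g t" if "t\<^sub>0 \<le> s" "s \<le> t" for s t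
    using that \<phi>_strict_mono[of s t] by (cases "s = t") (auto simp: g_def)
  have "((\<lambda>t. deriv ?\<phi>1 t *\<^sub>R f (g t)) has_integral integral {g a..g b} f) {a..b}"
  proof (rule has_integral_substitution_strong[of "{}" _ _ _ "-1" 1])
    show "g ` {a..b} \<subseteq> {-1..1}"
      using g_mono[of a] g_mono[of _ b] a ga by force
    show "continuous_on {a..b} g"
      using a by (intro continuous_at_imp_continuous_on) (auto intro!: DERIV_isCont[OF g])
    show "(g has_real_derivative deriv ?\<phi>1 t) (at t within {a..b})" if "t \<in> {a..b} - {}" for t
      using that a by (intro has_field_derivative_at_within[OF g]) auto
  qed (use \<open>a < b\<close> ga f in auto)
  then show ?thesis
    by (simp add: a b ga) (simp add: g_def mult.commute)
qed

end

theorem corollary2: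
  fixes \<mu> \<phi> \<phi>\<^sub>1 :: "real \<Rightarrow> real" and y\<^sub>0 t\<^sub>0 :: real
  assumes "ladder_scale y\<^sub>0 \<mu>"
    and "jacobs_ladder y\<^sub>0 \<mu> t\<^sub>0 \<phi>"
  defines "\<phi>\<^sub>1 \<equiv> \<lambda>t. \<phi> t / 2"
  shows "\<exists>T\<^sub>0. \<forall>T\<ge>T\<^sub>0.
    let a = inv_into {t\<^sub>0..} \<phi>\<^sub>1 T; b = inv_into {t\<^sub>0..} \<phi>\<^sub>1 (T + 2) in
      (\<forall>m n. m \<noteq> n \<longrightarrow>
        ((\<lambda>t. legendre_P m (\<phi>\<^sub>1 t - T - 1) * legendre_P n (\<phi>\<^sub>1 t - T - 1) * deriv \<phi>\<^sub>1 t)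
          has_integral 0) {a..b}) \<and>
      (\<forall>n. ((\<lambda>t. (legendre_P n (\<phi>\<^sub>1 t - T - 1))\<^sup>2 * deriv \<phi>\<^sub>1 t)
          has_integral (2 / (2 * real n + 1))) {a..b})"
proof -
  interpret ladder "\<lambda>t. (hardy_Z t)\<^sup>2" \<mu> \<phi> y\<^sub>0 t\<^sub>0
  proof
    show "\<exists>t\<in>{a<..<b}. (hardy_Z t)\<^sup>2 \<noteq> 0" if "a < b" for a b
      using hardy_Z_nonzero_in_interval[OF that] by simp
  qed (use assms(1,2) in \<open>auto simp: jacobs_ladder_def intro!: continuous_intros continuous_on_hardy_Z\<close>)
  have "((\<lambda>t. legendre_P m (\<phi>\<^sub>1 t - T - 1) * legendre_P n (\<phi>\<^sub>1 t - T - 1) * deriv \<phi>\<^sub>1 t)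
      has_integral integral {-1..1} (\<lambda>x. legendre_P m x * legendre_P n x))
      {inv_into {t\<^sub>0..} \<phi>\<^sub>1 T..inv_into {t\<^sub>0..} \<phi>\<^sub>1 (T + 2)}"
    if "T \<ge> \<phi> (t\<^sub>0 + 1) / 2" for T m n
    unfolding \<phi>\<^sub>1_def
    by (rule \<phi>_substitution[OF that, of "\<lambda>x. legendre_P m x * legendre_P n x"])
      (intro continuous_intros)
  note substitution = this
  show ?thesis
    unfolding Let_def
  \<comment> \<open>The threshold is that of the substitution lemma, so it is the same for all
    \<open>m\<close> and \<open>n\<close>.\<close>
  proof (intro exI[of _ "\<phi> (t\<^sub>0 + 1) / 2"] allI impI conjI)
    fix T :: real and m n :: nat
    assume "T \<ge> \<phi> (t\<^sub>0 + 1) / 2" and "m \<noteq> n"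
    from substitution[OF this(1), of m n]
    show "((\<lambda>t. legendre_P m (\<phi>\<^sub>1 t - T - 1) * legendre_P n (\<phi>\<^sub>1 t - T - 1) * deriv \<phi>\<^sub>1 t)
        has_integral 0) {inv_into {t\<^sub>0..} \<phi>\<^sub>1 T..inv_into {t\<^sub>0..} \<phi>\<^sub>1 (T + 2)}"
      unfolding legendre_orthogonal[OF \<open>m \<noteq> n\<close>] .
  next
    fix T :: real and n :: nat
    assume "T \<ge> \<phi> (t\<^sub>0 + 1) / 2"
    from substitution[OF this, of n n]
    show "((\<lambda>t. (legendre_P n (\<phi>\<^sub>1 t - T - 1))\<^sup>2 * deriv \<phi>\<^sub>1 t)
        has_integral (2 / (2 * real n + 1))) {inv_into {t\<^sub>0..} \<phi>\<^sub>1 T..inv_into {t\<^sub>0..} \<phi>\<^sub>1 (T + 2)}"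
      unfolding power2_eq_square[symmetric] integral_legendre_P_square .
  qed
qed

end
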